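(* Let $y_0=(x_0,a_0)\in\mathbb{R}\times\mathbb{R}^d$ and suppose $P_{x_0}(A_0=a_0)=1$. Suppose that the limit $$M_s(y_0,f;y):=\lim_{t\to\infty}\frac{\Lambda_{t-s}(f)(y)}{\Lambda_t(f)(y_0)}$$ exists for any $s\ge 0$ and any $y=(x,a)\in\mathbb{R}\times\mathbb{R}^d$, and that $$\frac{\Lambda_{t-s}(f)(y)}{\Lambda_t(f)(y_0)}\le C(s,y)\quad\text{for all } t>s,$$ where $E_{x_0}[C(s,Y_s)]<\infty$ (for every $s\ge 0$). Then: 1. $(M_s:=M_s(y_0,f;Y_s);\ s\ge 0)$ is a non-negative $P_{x_0}$-martingale, and $M_0=1$, $P_{x_0}$-a.s. 2. $Q^F_{x_0,t}$ converges weakly to $Q^M_{x_0}$ as $t\to\infty$, i.e. $\lim_{t\to\infty}Q^F_{x_0,t}(\Gamma_s)=Q^M_{x_0}(\Gamma_s)$ for every $s>0$ and every $\Gamma_s\in\mathcal{F}_s$, where $$Q^M_{x_0}(\Gamma_s)=E_{x_0}[1_{\Gamma_s}M_s],\qquad \Gamma_s\in\mathcal{F}_s,\ s\ge 0.$$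
   Context: $\Omega=\mathcal{C}(\mathbb{R}_+,\mathbb{R})$ is the canonical space, $(X_t)_{t\ge0}$ the coordinate process, $\mathcal{F}_t=\sigma(X_s;0\le s\le t)$, and $(P_x)_{x\in\mathbb{R}}$ the Wiener measures ($P_x$ is the law of Brownian motion started at $x$), with expectation $E_x$. $(A_t)_{t\ge0}$ is an $(\mathcal{F}_t)$-adapted $\mathbb{R}^d$-valued process such that $(Y_t=(X_t,A_t);t\ge0)$ is a $((P_x)_{x\in\mathbb{R}};(\mathcal{F}_t)_{t\ge0})$-Markov process, with semigroup $\Lambda_t(y,dy')$, $t\ge0$, $y,y'\in\mathbb{R}\times\mathbb{R}^d$; $\Lambda_t(f)(y)=\int f(y')\Lambda_t(y,dy')$. $f:\mathbb{R}\times\mathbb{R}^d\to\,]0,+\infty[$ is a Borel function, $F_t=f(X_t,A_t)$, with $0<E_x[F_t]<\infty$ for all $t\ge 0$, $x\in\mathbb{R}$. For $t\ge0$, $Q^F_{x,t}$ is the probability measure on $(\Omega,\mathcal{F}_t)$ given by $Q^F_{x,t}(\Gamma_t)=E_x[1_{\Gamma_t}F_t]/E_x[F_t]$, $\Gamma_t\in\mathcal{F}_t$. *)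

theory Defs
  imports "HOL-Probability.Probability"
begin

section \<open>Canonical space, canonical filtration, Wiener measures\<close>

text \<open>Paths on the half line are functions on the reals that are fixed to be \<^const>\<open>undefined\<close>
  off \<open>{0..}\<close>, so that two paths are equal iff they agree on \<open>{0..}\<close>.\<close>

type_synonym path = "real \<Rightarrow> real"

definition Omega :: "path set" where
  "Omega = {w \<in> extensional {0..}. continuous_on {0..} w}"

definition coord :: "real \<Rightarrow> path \<Rightarrow> real" where
  "coord t w = w t"

definition coord_algebra :: "real set \<Rightarrow> path measure" where
  "coord_algebra T = sigma Omega {coord s -` B \<inter> Omega | s B. s \<in> T \<and> B \<in> sets borel}"

text \<open>The filtration is the raw one (not completed).\<close>

definition Filt :: "real \<Rightarrow> path measure" where
  "Filt t = coord_algebra {0..t}"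

definition Filt_inf :: "path measure" where
  "Filt_inf = coord_algebra {0..}"

definition wiener_measure :: "real \<Rightarrow> path measure \<Rightarrow> bool" where
  "wiener_measure x P \<longleftrightarrow>
     prob_space P \<and> space P = Omega \<and> sets P = sets Filt_inf \<and>
     (AE w in P. coord 0 w = x) \<and>
     (\<forall>s t. 0 \<le> s \<and> s < t \<longrightarrow>
        distributed P lborel (\<lambda>w. coord t w - coord s w) (normal_density 0 (sqrt (t - s)))) \<and>
     (\<forall>n (\<tau>::nat \<Rightarrow> real). 0 \<le> \<tau> 0 \<and> mono \<tau> \<longrightarrow>
        prob_space.indep_vars P (\<lambda>_. borel)
          (\<lambda>i w. coord (\<tau> (Suc i)) w - coord (\<tau> i) w) {..<n})"

section \<open>Adapted processes, martingales, Markov processes\<close>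

text \<open>Time is represented by the type \<^typ>\<open>real\<close>; only times \<open>t \<ge> 0\<close> matter.\<close>

definition adapted :: "(real \<Rightarrow> 'a measure) \<Rightarrow> (real \<Rightarrow> 'a \<Rightarrow> 'b::topological_space) \<Rightarrow> bool" where
  "adapted F Z \<longleftrightarrow> (\<forall>t\<ge>0. Z t \<in> borel_measurable (F t))"

definition martingale ::
  "'a measure \<Rightarrow> (real \<Rightarrow> 'a measure) \<Rightarrow> (real \<Rightarrow> 'a \<Rightarrow> real) \<Rightarrow> bool" where
  "martingale P F Z \<longleftrightarrow>
     adapted F Z \<and> (\<forall>t\<ge>0. integrable P (Z t)) \<and>
     (\<forall>s t. 0 \<le> s \<and> s \<le> t \<longrightarrow> (AE w in P. real_cond_exp P (F s) (Z t) w = Z s w))"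

definition markov_semigroup :: "(real \<Rightarrow> 'b \<Rightarrow> 'b::topological_space measure) \<Rightarrow> bool" where
  "markov_semigroup \<Lambda> \<longleftrightarrow>
     (\<forall>t\<ge>0. \<Lambda> t \<in> borel \<rightarrow>\<^sub>M prob_algebra borel) \<and>
     (\<forall>y. \<Lambda> 0 y = return borel y) \<and>
     (\<forall>s\<ge>0. \<forall>t\<ge>0. \<forall>y. \<Lambda> (s + t) y = \<Lambda> s y \<bind> \<Lambda> t)"

definition markov_process ::
  "'a measure \<Rightarrow> (real \<Rightarrow> 'a measure) \<Rightarrow> (real \<Rightarrow> 'a \<Rightarrow> 'b::topological_space) \<Rightarrow>
   (real \<Rightarrow> 'b \<Rightarrow> 'b measure) \<Rightarrow> bool" where
  "markov_process P F Y \<Lambda> \<longleftrightarrow>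
     adapted F Y \<and>
     (\<forall>s\<ge>0. \<forall>t\<ge>0. \<forall>g :: 'b \<Rightarrow> real. g \<in> borel_measurable borel \<and> bounded (range g) \<longrightarrow>
        (AE w in P. real_cond_exp P (F s) (\<lambda>w. g (Y (s + t) w)) w = (\<integral>y. g y \<partial>\<Lambda> t (Y s w))))"

section \<open>The penalised measures and the limit functional\<close>

definition joint :: "(real \<Rightarrow> path \<Rightarrow> 'v) \<Rightarrow> real \<Rightarrow> path \<Rightarrow> real \<times> 'v" where
  "joint A t w = (coord t w, A t w)"

text \<open>\<open>\<Lambda>\<^sub>t(f)(y)\<close> is taken in \<open>[0,\<infinity>]\<close>, since nothing makes it finite at an arbitrary \<open>y\<close>.\<close>

definition act :: "(real \<Rightarrow> 'b \<Rightarrow> 'b measure) \<Rightarrow> ('b \<Rightarrow> real) \<Rightarrow> real \<Rightarrow> 'b \<Rightarrow> ennreal" where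
  "act \<Lambda> f t y = (\<integral>\<^sup>+ y'. ennreal (f y') \<partial>\<Lambda> t y)"

definition act_ratio ::
  "(real \<Rightarrow> 'b \<Rightarrow> 'b measure) \<Rightarrow> ('b \<Rightarrow> real) \<Rightarrow> 'b \<Rightarrow> real \<Rightarrow> 'b \<Rightarrow> real \<Rightarrow> ennreal" where
  "act_ratio \<Lambda> f y0 s y t = act \<Lambda> f (t - s) y / act \<Lambda> f t y0"

definition limM ::
  "(real \<Rightarrow> 'b \<Rightarrow> 'b measure) \<Rightarrow> ('b \<Rightarrow> real) \<Rightarrow> 'b \<Rightarrow> real \<Rightarrow> 'b \<Rightarrow> real" where
  "limM \<Lambda> f y0 s y = enn2real (Lim at_top (act_ratio \<Lambda> f y0 s y))"

text \<open>Meaningful for \<open>\<Gamma> \<in> sets (Filt t)\<close>.\<close>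

definition QF ::
  "(real \<Rightarrow> path measure) \<Rightarrow> (real \<Rightarrow> path \<Rightarrow> real) \<Rightarrow> real \<Rightarrow> real \<Rightarrow> path set \<Rightarrow> real" where
  "QF P F x t \<Gamma> = (\<integral>w. indicator \<Gamma> w * F t w \<partial>P x) / (\<integral>w. F t w \<partial>P x)"

end

theory Submission
  imports Defs
begin

text \<open>Let \<open>\<Gamma> \<in> \<F>\<^sub>s\<close>, \<open>Y\<^sub>t = (X\<^sub>t, A\<^sub>t)\<close> and \<open>D\<^sub>t = \<Lambda>\<^sub>t(f)(y\<^sub>0) = E[f(Y\<^sub>t)]\<close>. For \<open>t > s\<close> the
  Markov property turns \<open>E[1\<^sub>\<Gamma> f(Y\<^sub>t)] / D\<^sub>t\<close> into \<open>E[1\<^sub>\<Gamma> \<Lambda>\<^sub>t\<^sub>-\<^sub>s(f)(Y\<^sub>s)] / D\<^sub>t\<close>, which by dominated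
  convergence tends to \<open>E[1\<^sub>\<Gamma> M\<^sub>s]\<close> as \<open>t \<rightarrow> \<infinity>\<close>. If \<open>s \<le> u\<close> then \<open>\<Gamma> \<in> \<F>\<^sub>u\<close> as well, so the same
  quantity tends to \<open>E[1\<^sub>\<Gamma> M\<^sub>u]\<close>; uniqueness of the limit is the martingale property.\<close>

section \<open>Semigroup kernels and their action on functions\<close>

lemma markov_semigroup_prob_algebra:
  assumes "markov_semigroup \<Lambda>" "0 \<le> t"
  shows "\<Lambda> t \<in> borel \<rightarrow>\<^sub>M prob_algebra borel"
    and "prob_space (\<Lambda> t y)" and "sets (\<Lambda> t y) = sets borel"
proof -
  show m: "\<Lambda> t \<in> borel \<rightarrow>\<^sub>M prob_algebra borel"
    using assms unfolding markov_semigroup_def by blast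
  have "\<Lambda> t y \<in> space (prob_algebra borel)"
    using measurable_space[OF m] by simp
  then show "prob_space (\<Lambda> t y)" "sets (\<Lambda> t y) = sets borel"
    by (auto simp: space_prob_algebra)
qed

lemma borel_measurable_act:
  assumes "markov_semigroup \<Lambda>" "0 \<le> t" "g \<in> borel_measurable borel"
  shows "act \<Lambda> g t \<in> borel_measurable borel"
proof -
  have "\<Lambda> t \<in> borel \<rightarrow>\<^sub>M subprob_algebra borel"
    using markov_semigroup_prob_algebra(1)[OF assms(1,2)] by (rule measurable_prob_algebraD)
  moreover have "(\<lambda>N. \<integral>\<^sup>+ y. ennreal (g y) \<partial>N) \<in> borel_measurable (subprob_algebra borel)"
    using assms(3) by (intro nn_integral_measurable_subprob_algebra) measurable
  ultimately show ?thesis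
    unfolding act_def[abs_def] by (rule measurable_compose)
qed

text \<open>Bridge between two integrals: \<open>markov_process\<close> speaks of the Bochner
  integral, \<open>act\<close> of the nonnegative one. They agree here because a bounded function is
  integrable under the probability measure \<open>\<Lambda> t y\<close>.\<close>

lemma act_bounded:
  assumes "markov_semigroup \<Lambda>" "0 \<le> t" "g \<in> borel_measurable borel"
    and "\<And>y. 0 \<le> g y" "bounded (range g)"
  shows "act \<Lambda> g t y = ennreal (\<integral>y'. g y' \<partial>\<Lambda> t y)"
proof -
  interpret prob_space "\<Lambda> t y" using markov_semigroup_prob_algebra(2)[OF assms(1,2)] .
  have [measurable_cong]: "sets (\<Lambda> t y) = sets borel"
    using markov_semigroup_prob_algebra(3)[OF assms(1,2)] .
  obtain B where "\<And>y. norm (g y) \<le> B"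
    using assms(5) by (auto simp: bounded_iff)
  then have "integrable (\<Lambda> t y) g"
    using assms(3) by (intro integrable_const_bound[of _ B]) auto
  then show ?thesis
    unfolding act_def using assms(4) by (intro nn_integral_eq_integral) auto
qed

section \<open>Truncation, and the Markov property for unbounded nonnegative functions\<close>

lemma SUP_min_of_nat:
  fixes r :: real
  assumes "0 \<le> r"
  shows "(SUP n. ennreal (min r (of_nat n))) = ennreal r"
proof (rule antisym)
  show "(SUP n. ennreal (min r (of_nat n))) \<le> ennreal r"
    by (intro SUP_least ennreal_leI) simp
  obtain n :: nat where "r \<le> of_nat n" using real_arch_simple by blast
  then show "ennreal r \<le> (SUP n. ennreal (min r (of_nat n)))"
    by (intro SUP_upper2[of n]) (auto simp: min_absorb1)
qed

text \<open>Monotone convergence along the cut-offs at integer levels. It carries identities known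
  for bounded functions over to \<open>f\<close>, for which no bound is assumed.\<close>

lemma nn_integral_min_of_nat:
  fixes h :: "'a \<Rightarrow> real"
  assumes [measurable]: "h \<in> borel_measurable N" "\<Gamma> \<in> sets N" and "\<And>x. 0 \<le> h x"
  shows "(\<integral>\<^sup>+x. indicator \<Gamma> x * ennreal (h x) \<partial>N) =
    (SUP n. \<integral>\<^sup>+x. indicator \<Gamma> x * ennreal (min (h x) (of_nat n)) \<partial>N)"
proof -
  have "(\<integral>\<^sup>+x. indicator \<Gamma> x * ennreal (h x) \<partial>N) =
      (\<integral>\<^sup>+x. (SUP n. indicator \<Gamma> x * ennreal (min (h x) (of_nat n))) \<partial>N)"
    using assms(3) by (simp add: SUP_mult_left_ennreal[symmetric] SUP_min_of_nat)
  also have "\<dots> = (SUP n. \<integral>\<^sup>+x. indicator \<Gamma> x * ennreal (min (h x) (of_nat n)) \<partial>N)"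
    by (intro nn_integral_monotone_convergence_SUP)
       (auto simp: incseq_def le_fun_def intro!: mult_left_mono ennreal_leI min.mono)
  finally show ?thesis .
qed

text \<open>The previous truncation under the measure \<open>\<Lambda> t y\<close>, with the whole
  space in place of \<open>\<Gamma>\<close>.\<close>

lemma act_min_of_nat:
  assumes "markov_semigroup \<Lambda>" "0 \<le> t" "g \<in> borel_measurable borel" "\<And>y. 0 \<le> g y"
  shows "act \<Lambda> g t y = (SUP n. act \<Lambda> (\<lambda>y. min (g y) (of_nat n)) t y)"
proof -
  have [measurable_cong]: "sets (\<Lambda> t y) = sets borel"
    using markov_semigroup_prob_algebra(3)[OF assms(1,2)] .
  have "g \<in> borel_measurable (\<Lambda> t y)" using assms(3) by measurable
  from nn_integral_min_of_nat[OF this sets.top assms(4)]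
  show ?thesis unfolding act_def
    by (simp add: indicator_def cong: nn_integral_cong_simp)
qed

text \<open>Integrating the conditional expectation of \<open>g (Y (s + t))\<close> over
  \<open>\<Gamma>\<close> gives the left side by its defining property, and the right side by the
  Markov property together with \<open>act_bounded\<close>.\<close>

lemma markov_process_nn_integral_bounded:
  fixes Y :: "real \<Rightarrow> 'a \<Rightarrow> 'b::topological_space"
  assumes "finite_measure_subalgebra P (F s)" "subalgebra P (F (s + t))"
    and \<Lambda>: "markov_semigroup \<Lambda>" and Y: "markov_process P F Y \<Lambda>"
    and st: "0 \<le> s" "0 \<le> t" and g: "g \<in> borel_measurable borel" "\<And>y. 0 \<le> g y" "bounded (range g)"
    and \<Gamma>: "\<Gamma> \<in> sets (F s)"
  shows "(\<integral>\<^sup>+w. indicator \<Gamma> w * ennreal (g (Y (s + t) w)) \<partial>P) =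
    (\<integral>\<^sup>+w. indicator \<Gamma> w * act \<Lambda> g t (Y s w) \<partial>P)"
proof -
  interpret finite_measure_subalgebra P "F s" by fact
  have "Y (s + t) \<in> borel_measurable (F (s + t))" "Y s \<in> borel_measurable (F s)"
    using Y st unfolding markov_process_def adapted_def by auto
  then have Ym: "Y (s + t) \<in> borel_measurable P"
    using measurable_from_subalg assms(2) by blast
  obtain B where B: "\<And>y. norm (g y) \<le> B"
    using g(3) by (auto simp: bounded_iff)
  have gm: "(\<lambda>w. g (Y (s + t) w)) \<in> borel_measurable P"
    using measurable_compose[OF Ym g(1)] .
  have gi: "integrable P (\<lambda>w. g (Y (s + t) w))"
    using gm B by (intro integrable_const_bound[of _ B]) auto
  have \<Gamma>P: "\<Gamma> \<in> sets P" using \<Gamma> subalg unfolding subalgebra_def by auto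
  let ?E = "real_cond_exp P (F s) (\<lambda>w. g (Y (s + t) w))"
  have cond: "AE w in P. ?E w = (\<integral>y. g y \<partial>\<Lambda> t (Y s w))"
    using Y st g unfolding markov_process_def by blast
  \<comment> \<open>Needed below to read the Bochner integral of \<open>?E\<close> over
    \<open>\<Gamma>\<close> as a nonnegative integral.\<close>
  have pos: "AE w in P. 0 \<le> ?E w"
    using gi gm g(2) by (intro real_cond_exp_pos) auto
  have Ei: "integrable P ?E" using gi by (rule real_cond_exp_int)
  have ind: "integrable P (\<lambda>w. indicator \<Gamma> w * h w)" if "integrable P h" for h :: "'a \<Rightarrow> real"
    using integrable_mult_indicator[OF \<Gamma>P that] by simp
  have "(\<integral>\<^sup>+w. indicator \<Gamma> w * ennreal (g (Y (s + t) w)) \<partial>P) =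
      (\<integral>\<^sup>+w. ennreal (indicator \<Gamma> w * g (Y (s + t) w)) \<partial>P)"
    by (intro nn_integral_cong) (simp split: split_indicator)
  also have "\<dots> = ennreal (\<integral>w. indicator \<Gamma> w * g (Y (s + t) w) \<partial>P)"
    using ind[OF gi] g(2) by (intro nn_integral_eq_integral) auto
  also have "(\<integral>w. indicator \<Gamma> w * g (Y (s + t) w) \<partial>P) = (\<integral>w. indicator \<Gamma> w * ?E w \<partial>P)"
    using real_cond_exp_intA[OF gi \<Gamma>] unfolding set_lebesgue_integral_def by simp
  also have "ennreal \<dots> = (\<integral>\<^sup>+w. ennreal (indicator \<Gamma> w * ?E w) \<partial>P)"
    using ind[OF Ei] pos by (intro nn_integral_eq_integral[symmetric]) auto
  also have "\<dots> = (\<integral>\<^sup>+w. indicator \<Gamma> w * act \<Lambda> g t (Y s w) \<partial>P)"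
    using cond by (intro nn_integral_cong_AE)
      (auto simp: act_bounded[OF \<Lambda> st(2) g] split: split_indicator)
  finally show ?thesis .
qed

text \<open>The bounded case applies to each cut-off of \<open>g\<close>. The left side passes to
  the supremum by monotone convergence under \<open>P\<close>; the right side needs it twice, under
  \<open>\<Lambda> t y\<close> inside \<open>act\<close> and then under \<open>P\<close>.\<close>

lemma markov_process_nn_integral:
  fixes Y :: "real \<Rightarrow> 'a \<Rightarrow> 'b::topological_space"
  assumes "finite_measure_subalgebra P (F s)" "subalgebra P (F (s + t))"
    and \<Lambda>: "markov_semigroup \<Lambda>" and Y: "markov_process P F Y \<Lambda>"
    and st: "0 \<le> s" "0 \<le> t" and g: "g \<in> borel_measurable borel" "\<And>y. 0 \<le> g y"
    and \<Gamma>: "\<Gamma> \<in> sets (F s)"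
  shows "(\<integral>\<^sup>+w. indicator \<Gamma> w * ennreal (g (Y (s + t) w)) \<partial>P) =
    (\<integral>\<^sup>+w. indicator \<Gamma> w * act \<Lambda> g t (Y s w) \<partial>P)"
proof -
  interpret finite_measure_subalgebra P "F s" by fact
  have "Y (s + t) \<in> borel_measurable (F (s + t))" "Y s \<in> borel_measurable (F s)"
    using Y st unfolding markov_process_def adapted_def by auto
  then have Ym: "Y (s + t) \<in> borel_measurable P" "Y s \<in> borel_measurable P"
    using measurable_from_subalg assms(2) subalg by blast+
  have [measurable]: "\<Gamma> \<in> sets P" using \<Gamma> subalg unfolding subalgebra_def by auto
  have gm: "(\<lambda>w. g (Y (s + t) w)) \<in> borel_measurable P"
    using measurable_compose[OF Ym(1) g(1)] .
  define h where "h n y = min (g y) (of_nat n)" for n :: nat and y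
  have h: "h n \<in> borel_measurable borel" "\<And>y. 0 \<le> h n y" "bounded (range (h n))" for n
    using g by (auto simp: h_def[abs_def] bounded_iff intro!: exI[of _ "of_nat n"])
  have [measurable]: "(\<lambda>w. act \<Lambda> (h n) t (Y s w)) \<in> borel_measurable P" for n
    by (intro measurable_compose[OF Ym(2)] borel_measurable_act \<Lambda> st h)
  have "incseq (\<lambda>n. act \<Lambda> (h n) t y)" for y
    unfolding act_def h_def by (auto simp: incseq_def intro!: nn_integral_mono ennreal_leI min.mono)
  then have mono: "incseq (\<lambda>n w. indicator \<Gamma> w * act \<Lambda> (h n) t (Y s w))"
    by (auto simp: incseq_def le_fun_def intro!: mult_left_mono)
  have "(\<integral>\<^sup>+w. indicator \<Gamma> w * ennreal (g (Y (s + t) w)) \<partial>P) =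
      (SUP n. \<integral>\<^sup>+w. indicator \<Gamma> w * ennreal (h n (Y (s + t) w)) \<partial>P)"
    unfolding h_def using gm g(2) by (intro nn_integral_min_of_nat) auto
  also have "\<dots> = (SUP n. \<integral>\<^sup>+w. indicator \<Gamma> w * act \<Lambda> (h n) t (Y s w) \<partial>P)"
    using markov_process_nn_integral_bounded[OF assms(1,2) \<Lambda> Y st h \<Gamma>] by simp
  also have "\<dots> = (\<integral>\<^sup>+w. (SUP n. indicator \<Gamma> w * act \<Lambda> (h n) t (Y s w)) \<partial>P)"
    using mono by (intro nn_integral_monotone_convergence_SUP[symmetric]) measurable
  also have "\<dots> = (\<integral>\<^sup>+w. indicator \<Gamma> w * act \<Lambda> g t (Y s w) \<partial>P)"
    by (simp add: act_min_of_nat[OF \<Lambda> st(2) g] h_def[abs_def] SUP_mult_left_ennreal)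
  finally show ?thesis .
qed

section \<open>The canonical filtration inside the Wiener space\<close>

lemma sets_Filt:
  "sets (Filt t) = sigma_sets Omega {coord s -` B \<inter> Omega | s B. s \<in> {0..t} \<and> B \<in> sets borel}"
  unfolding Filt_def coord_algebra_def by (subst sets_measure_of) auto

lemma sets_Filt_inf:
  "sets Filt_inf = sigma_sets Omega {coord s -` B \<inter> Omega | s B. s \<in> {0..} \<and> B \<in> sets borel}"
  unfolding Filt_inf_def coord_algebra_def by (subst sets_measure_of) auto

lemma sets_Filt_mono: "s \<le> t \<Longrightarrow> sets (Filt s) \<subseteq> sets (Filt t)"
  unfolding sets_Filt by (intro sigma_sets_mono') force

text \<open>The generators of \<open>Filt t\<close> are among those of \<open>Filt_inf\<close>. No
  sign condition on \<open>t\<close> arises: for negative \<open>t\<close> there are no generators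
  at all.\<close>

lemma wiener_measure_subalgebra:
  assumes "wiener_measure x P"
  shows "subalgebra P (Filt t)"
proof -
  have "space (Filt t) = Omega"
    unfolding Filt_def coord_algebra_def by (rule space_measure_of) auto
  moreover have "sets (Filt t) \<subseteq> sets Filt_inf"
    unfolding sets_Filt sets_Filt_inf by (intro sigma_sets_mono') force
  ultimately show ?thesis
    using assms unfolding wiener_measure_def subalgebra_def by simp
qed

theorem theorem1p1:
  fixes P :: "real \<Rightarrow> path measure"
    and A :: "real \<Rightarrow> path \<Rightarrow> real ^ 'd"
    and \<Lambda> :: "real \<Rightarrow> real \<times> (real ^ 'd) \<Rightarrow> (real \<times> (real ^ 'd)) measure"
    and f :: "real \<times> (real ^ 'd) \<Rightarrow> real"
    and C :: "real \<Rightarrow> real \<times> (real ^ 'd) \<Rightarrow> real"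
    and x0 :: real and a0 :: "real ^ 'd"
  assumes wiener: "\<And>x. wiener_measure x (P x)"
    and adapted_A: "adapted Filt A"
    and semigroup: "markov_semigroup \<Lambda>"
    and markov: "\<And>x. markov_process (P x) Filt (joint A) \<Lambda>"
    and f_borel: "f \<in> borel_measurable borel"
    and f_pos: "\<And>y. f y > 0"
    and f_mean: "\<And>x t. t \<ge> 0 \<Longrightarrow>
        0 < (\<integral>\<^sup>+ w. ennreal (f (joint A t w)) \<partial>P x) \<and> (\<integral>\<^sup>+ w. ennreal (f (joint A t w)) \<partial>P x) < \<infinity>"
    and start: "measure (P x0) {w \<in> space (P x0). A 0 w = a0} = 1"
    and limit_exists: "\<And>s y. s \<ge> 0 \<Longrightarrow> \<exists>l::real. l \<ge> 0 \<and>
        (act_ratio \<Lambda> f (x0, a0) s y \<longlongrightarrow> ennreal l) at_top"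
    and bound: "\<And>s y t. s \<ge> 0 \<Longrightarrow> t > s \<Longrightarrow> act_ratio \<Lambda> f (x0, a0) s y t \<le> ennreal (C s y)"
    and C_mean: "\<And>s. s \<ge> 0 \<Longrightarrow> integrable (P x0) (\<lambda>w. C s (joint A s w))"
  defines "M \<equiv> \<lambda>s w. limM \<Lambda> f (x0, a0) s (joint A s w)"
  shows "martingale (P x0) Filt M \<and>
     (\<forall>s\<ge>0. \<forall>w\<in>Omega. M s w \<ge> 0) \<and>
     (AE w in P x0. M 0 w = 1) \<and>
     (\<exists>QM :: path set \<Rightarrow> real.
        (\<forall>s\<ge>0. \<forall>\<Gamma>\<in>sets (Filt s). QM \<Gamma> = (\<integral>w. indicator \<Gamma> w * M s w \<partial>P x0)) \<and>
        (\<forall>s>0. \<forall>\<Gamma>\<in>sets (Filt s).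
           ((\<lambda>t. QF P (\<lambda>t w. f (joint A t w)) x0 t \<Gamma>) \<longlongrightarrow> QM \<Gamma>) at_top))"
proof -
  let ?P = "P x0" and ?y0 = "(x0, a0)"
  define Y where "Y = joint A"
  define D where "D t = act \<Lambda> f t ?y0" for t
  define R where "R s y t = act_ratio \<Lambda> f ?y0 s y t" for s y t
  define m where "m s y = limM \<Lambda> f ?y0 s y" for s y
  interpret P: prob_space ?P
    using wiener unfolding wiener_measure_def by blast
  note sub = wiener_measure_subalgebra[OF wiener[of x0]]
  have fin: "finite_measure_subalgebra ?P (Filt s)" for s
    by standard (rule sub)
  have mp: "markov_process ?P Filt Y \<Lambda>"
    unfolding Y_def by (rule markov)
  have M_m: "M s w = m s (Y s w)" for s w
    unfolding M_def m_def Y_def ..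
  have Y_F: "Y t \<in> borel_measurable (Filt t)" if "0 \<le> t" for t
    using mp that unfolding markov_process_def adapted_def by auto
  have Y_P: "Y t \<in> borel_measurable ?P" if "0 \<le> t" for t
    using measurable_from_subalg[OF sub Y_F[OF that]] .
  have f0: "0 \<le> f y" for y using f_pos[of y] by simp
  have \<Gamma>_P: "\<Gamma> \<in> sets ?P" if "\<Gamma> \<in> sets (Filt s)" for \<Gamma> s
    using sub that unfolding subalgebra_def by auto
  note Markov = markov_process_nn_integral[OF fin sub semigroup mp _ _ f_borel f0]

  \<comment> \<open>\<open>measure\<close> is 0 on sets outside the sigma-algebra, so the value 1 in
    \<open>start\<close> already forces this event to be measurable.\<close>
  have "{w \<in> space ?P. A 0 w = a0} \<in> P.events"
    using start by (metis measure_notin_sets zero_neq_one)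
  then have "AE w in ?P. A 0 w = a0"
    using P.AE_prob_1[OF start] by auto
  moreover have "AE w in ?P. coord 0 w = x0"
    using wiener[of x0] unfolding wiener_measure_def by blast
  ultimately have Y_0: "AE w in ?P. Y 0 w = ?y0"
    by eventually_elim (simp add: Y_def joint_def)

  have D_eq: "(\<integral>\<^sup>+w. ennreal (f (Y t w)) \<partial>?P) = D t" if "0 \<le> t" for t
  proof -
    \<comment> \<open>The Markov property at time 0 over the whole space; since \<open>Y 0\<close>
      equals \<open>?y0\<close> almost surely, the integrand on the right is the constant
      \<open>D t\<close>.\<close>
    have "space ?P \<in> sets (Filt 0)"
      using sub[of 0] sets.top[of "Filt 0"] unfolding subalgebra_def by simp
    from Markov[OF order.refl that this]
    have "(\<integral>\<^sup>+w. ennreal (f (Y t w)) \<partial>?P) = (\<integral>\<^sup>+w. act \<Lambda> f t (Y 0 w) \<partial>?P)"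
      by (simp cong: nn_integral_cong_simp)
    also have "\<dots> = (\<integral>\<^sup>+w. D t \<partial>?P)"
      using Y_0 by (intro nn_integral_cong_AE) (auto simp: D_def)
    finally show ?thesis by (simp add: P.emeasure_space_1)
  qed
  \<comment> \<open>Both bounds matter in [0,\<infinity>]: they make \<open>D t / D t\<close> equal
    to 1 and \<open>f (Y t)\<close> integrable.\<close>
  have D_pos: "0 < D t" "D t < \<infinity>" if "0 \<le> t" for t
    using f_mean[OF that, of x0] D_eq[OF that] unfolding Y_def by auto

  \<comment> \<open>The ratios, their limit, and its measurability\<close>
  have R_meas: "(\<lambda>y. R s y t) \<in> borel_measurable borel" if "0 \<le> s" "s \<le> t" for s t
  proof -
    have "act \<Lambda> f (t - s) \<in> borel_measurable borel"
      using semigroup f_borel that by (intro borel_measurable_act) auto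
    then show ?thesis unfolding R_def act_ratio_def by measurable
  qed
  have R_lim: "((\<lambda>t. R s y t) \<longlongrightarrow> ennreal (m s y)) at_top" if s: "0 \<le> s" for s y
  proof -
    \<comment> \<open>\<open>limM\<close> applies \<open>enn2real\<close>, which sends infinity to
      0. The limit here is a finite \<open>ennreal l\<close>, so nothing is lost by converting
      back.\<close>
    obtain l where "0 \<le> l" "(act_ratio \<Lambda> f ?y0 s y \<longlongrightarrow> ennreal l) at_top"
      using limit_exists[OF s] by blast
    moreover from this have "Lim at_top (act_ratio \<Lambda> f ?y0 s y) = ennreal l"
      by (intro tendsto_Lim) auto
    ultimately show ?thesis
      by (simp add: R_def[abs_def] m_def limM_def)
  qed
  have m_nonneg: "0 \<le> m s y" for s y unfolding m_def limM_def by simp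
  have m_meas: "m s \<in> borel_measurable borel" if s: "0 \<le> s" for s
  proof -
    have "(\<lambda>y. ennreal (m s y)) \<in> borel_measurable borel"
    proof (rule borel_measurable_LIMSEQ_order)
      \<comment> \<open>Measurability passes only to countable limits, so the limit is taken along
        the times \<open>s + n\<close>; these are at least \<open>s\<close>, as
        \<open>R_meas\<close> requires.\<close>
      have "filterlim (\<lambda>n. s + real n) at_top sequentially"
        by (intro filterlim_tendsto_add_at_top[OF tendsto_const] filterlim_real_sequentially)
      then show "(\<lambda>n. R s y (s + real n)) \<longlonglongrightarrow> ennreal (m s y)" for y
        using R_lim[OF s] by (rule filterlim_compose[rotated])
      show "(\<lambda>y. R s y (s + real n)) \<in> borel_measurable borel" for n
        using s by (intro R_meas) auto
    qed
    then have "(\<lambda>y. enn2real (ennreal (m s y))) \<in> borel_measurable borel" by measurable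
    then show ?thesis using m_nonneg by simp
  qed
  have M_F: "M s \<in> borel_measurable (Filt s)" if "0 \<le> s" for s
    using measurable_compose[OF Y_F m_meas] that unfolding M_m[abs_def] by blast
  have M_P: "M s \<in> borel_measurable ?P" if "0 \<le> s" for s
    using measurable_from_subalg[OF sub M_F[OF that]] .
  have M_nonneg: "0 \<le> M s w" for s w unfolding M_m by (rule m_nonneg)
  \<comment> \<open>\<open>C\<close> carries no sign assumption; \<open>ennreal\<close> keeps its
    positive part, whose integral is finite because \<open>C s (Y s)\<close> is integrable.\<close>
  have C_int: "(\<integral>\<^sup>+w. ennreal (C s (Y s w)) \<partial>?P) < \<infinity>" if "0 \<le> s" for s
    using C_mean[OF that] unfolding Y_def
    by (metis infinity_ennreal_def integrableD(2) less_top real_integrable_def)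
  have C_P: "(\<lambda>w. ennreal (C s (Y s w))) \<in> borel_measurable ?P" if "0 \<le> s" for s
    using C_mean[OF that] unfolding Y_def by measurable

  \<comment> \<open>Convergence of the normalised expectations\<close>
  have key: "((\<lambda>t. (\<integral>\<^sup>+w. indicator \<Gamma> w * ennreal (f (Y t w)) \<partial>?P) / D t) \<longlongrightarrow>
      (\<integral>\<^sup>+w. indicator \<Gamma> w * ennreal (M s w) \<partial>?P)) at_top"
    if s: "0 \<le> s" and \<Gamma>: "\<Gamma> \<in> sets (Filt s)" for s \<Gamma>
  proof -
    note [measurable] = \<Gamma>_P[OF \<Gamma>] C_P[OF s] M_P[OF s]
    have eq: "(\<integral>\<^sup>+w. indicator \<Gamma> w * R s (Y s w) t \<partial>?P) =
        (\<integral>\<^sup>+w. indicator \<Gamma> w * ennreal (f (Y t w)) \<partial>?P) / D t" if t: "s < t" for t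
    proof -
      have [measurable]: "(\<lambda>w. act \<Lambda> f (t - s) (Y s w)) \<in> borel_measurable ?P"
        using t by (intro measurable_compose[OF Y_P[OF s]] borel_measurable_act semigroup f_borel) auto
      show ?thesis
        using Markov[OF s _ \<Gamma>, of "t - s"] t
        by (simp add: R_def act_ratio_def D_def[symmetric] ennreal_times_divide nn_integral_divide)
    qed
    have "((\<lambda>t. \<integral>\<^sup>+w. indicator \<Gamma> w * R s (Y s w) t \<partial>?P) \<longlongrightarrow>
        (\<integral>\<^sup>+w. indicator \<Gamma> w * ennreal (M s w) \<partial>?P)) at_top"
    \<comment> \<open>Dominated convergence is a statement about sequences, so the limit is tested
      along an arbitrary sequence \<open>X\<close> of times tending to infinity.\<close>
    proof (rule tendsto_at_topI_sequentially)
      fix X :: "nat \<Rightarrow> real"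
      assume X: "filterlim X at_top sequentially"
      \<comment> \<open>The domination \<open>bound\<close> is available only for times beyond
        \<open>s\<close>. The first \<open>N\<close> terms are therefore dropped, and
        \<open>LIMSEQ_offset\<close> puts them back at the end.\<close>
      then obtain N where N: "\<And>n. N \<le> n \<Longrightarrow> s < X n"
        by (auto simp: filterlim_at_top_dense eventually_sequentially)
      have X': "filterlim (\<lambda>n. X (n + N)) at_top sequentially"
        using filterlim_compose[OF X filterlim_add_const_nat_at_top] .
      have [measurable]: "(\<lambda>w. R s (Y s w) (X (n + N))) \<in> borel_measurable ?P" for n
        using s N[of "n + N"] by (intro measurable_compose[OF Y_P[OF s]] R_meas) auto
      have "(\<lambda>n. \<integral>\<^sup>+w. indicator \<Gamma> w * R s (Y s w) (X (n + N)) \<partial>?P) \<longlonglongrightarrow>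
          (\<integral>\<^sup>+w. indicator \<Gamma> w * ennreal (M s w) \<partial>?P)"
      proof (rule nn_integral_dominated_convergence[OF _ _ C_P[OF s] _ C_int[OF s]])
        show "AE w in ?P. indicator \<Gamma> w * R s (Y s w) (X (n + N)) \<le> ennreal (C s (Y s w))" for n
          using bound[OF s N[of "n + N"]] by (auto simp: R_def split: split_indicator)
        show "AE w in ?P. (\<lambda>n. indicator \<Gamma> w * R s (Y s w) (X (n + N))) \<longlonglongrightarrow>
            indicator \<Gamma> w * ennreal (M s w)"
          using filterlim_compose[OF R_lim[OF s] X'] unfolding M_m
          by (intro AE_I2) (simp split: split_indicator)
      qed measurable
      then show "(\<lambda>n. \<integral>\<^sup>+w. indicator \<Gamma> w * R s (Y s w) (X n) \<partial>?P) \<longlonglongrightarrow>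
          (\<integral>\<^sup>+w. indicator \<Gamma> w * ennreal (M s w) \<partial>?P)"
        by (rule LIMSEQ_offset)
    qed
    then show ?thesis
      by (rule Lim_transform_eventually) (rule eventually_mono[OF eventually_gt_at_top[of s] eq])
  qed

  \<comment> \<open>Consistency, integrability and the martingale property\<close>
  have M_consistent: "(\<integral>\<^sup>+w. indicator \<Gamma> w * ennreal (M s w) \<partial>?P) =
      (\<integral>\<^sup>+w. indicator \<Gamma> w * ennreal (M u w) \<partial>?P)"
    if "0 \<le> s" "s \<le> u" "\<Gamma> \<in> sets (Filt s)" for s u \<Gamma>
    using key[of s \<Gamma>] key[of u \<Gamma>] that sets_Filt_mono[of s u]
    by (intro tendsto_unique[of at_top]) auto

  have M_int: "integrable ?P (M s)" if s: "0 \<le> s" for s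
  proof (rule integrableI_bounded[OF M_P[OF s]])
    \<comment> \<open>The bound on the ratios survives the limit, so \<open>M s\<close> inherits
      integrability from \<open>C s (Y s)\<close>.\<close>
    have "ennreal (m s y) \<le> ennreal (C s y)" for y
    proof (rule tendsto_upperbound[OF R_lim[OF s]])
      show "\<forall>\<^sub>F t in at_top. R s y t \<le> ennreal (C s y)"
        unfolding R_def by (rule eventually_mono[OF eventually_gt_at_top[of s] bound[OF s]])
    qed simp
    then have "ennreal (norm (M s w)) \<le> ennreal (C s (Y s w))" for w
      using M_nonneg[of s w] unfolding M_m by simp
    then show "(\<integral>\<^sup>+w. ennreal (norm (M s w)) \<partial>?P) < \<infinity>"
      using C_int[OF s] by (meson le_less_trans nn_integral_mono)
  qed
  \<comment> \<open>Translates the [0,\<infinity>]-valued limits of \<open>key\<close> into the real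
    integrals used for the martingale and for \<open>QM\<close>.\<close>
  have M_ind: "(\<integral>\<^sup>+w. indicator \<Gamma> w * ennreal (M s w) \<partial>?P) = ennreal (\<integral>w. indicator \<Gamma> w * M s w \<partial>?P)"
    if "0 \<le> s" "\<Gamma> \<in> sets ?P" for s \<Gamma>
  proof -
    have "integrable ?P (\<lambda>w. indicator \<Gamma> w * M s w)"
      using integrable_mult_indicator[OF that(2) M_int[OF that(1)]] by simp
    then have "(\<integral>\<^sup>+w. ennreal (indicator \<Gamma> w * M s w) \<partial>?P) = ennreal (\<integral>w. indicator \<Gamma> w * M s w \<partial>?P)"
      using M_nonneg by (intro nn_integral_eq_integral) auto
    then show ?thesis
      using M_nonneg by (simp add: ennreal_mult' ennreal_indicator)
  qed

  have "martingale ?P Filt M"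
    unfolding martingale_def adapted_def
  proof (intro conjI allI impI)
    fix s t :: real assume st: "0 \<le> s \<and> s \<le> t"
    interpret S: finite_measure_subalgebra ?P "Filt s" by (rule fin)
    show "AE w in ?P. real_cond_exp ?P (Filt s) (M t) w = M s w"
    \<comment> \<open>The conditional expectation is determined by its integrals over sets of
      \<open>Filt s\<close>, given that \<open>M s\<close> is integrable and
      \<open>Filt s\<close>-measurable; \<open>M_consistent\<close> supplies the equality of these
      integrals.\<close>
    proof (rule S.real_cond_exp_charact)
      fix \<Gamma> assume \<Gamma>: "\<Gamma> \<in> sets (Filt s)"
      have "ennreal (\<integral>w. indicator \<Gamma> w * M t w \<partial>?P) = ennreal (\<integral>w. indicator \<Gamma> w * M s w \<partial>?P)"
        using M_consistent[OF _ _ \<Gamma>, of t] M_ind[OF _ \<Gamma>_P[OF \<Gamma>]] st by simp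
      then have "(\<integral>w. indicator \<Gamma> w * M t w \<partial>?P) = (\<integral>w. indicator \<Gamma> w * M s w \<partial>?P)"
        using M_nonneg by (subst (asm) ennreal_inj) (auto intro!: Bochner_Integration.integral_nonneg)
      then show "(\<integral>w\<in>\<Gamma>. M t w \<partial>?P) = (\<integral>w\<in>\<Gamma>. M s w \<partial>?P)"
        unfolding set_lebesgue_integral_def by simp
    qed (use st M_int M_F in auto)
  qed (use M_int M_F in auto)

  \<comment> \<open>The initial value\<close>
  moreover have "AE w in ?P. M 0 w = 1"
  proof -
    have "((\<lambda>t. R 0 ?y0 t) \<longlongrightarrow> 1) at_top"
    proof (rule tendsto_eventually)
      \<comment> \<open>At \<open>s = 0\<close> and \<open>y = ?y0\<close> numerator and denominator
        are both \<open>D t\<close>.\<close>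
      have "R 0 ?y0 t = 1" if "0 \<le> t" for t
        using ennreal_divide_self D_pos[OF that] unfolding R_def act_ratio_def D_def by simp
      then show "\<forall>\<^sub>F t in at_top. R 0 ?y0 t = 1"
        by (rule eventually_mono[OF eventually_ge_at_top[of 0]])
    qed
    then have "ennreal (m 0 ?y0) = 1"
      using R_lim[of 0 ?y0] by (intro tendsto_unique[of at_top]) auto
    then have "m 0 ?y0 = 1" by simp
    then show ?thesis using Y_0 unfolding M_m by auto
  qed

  \<comment> \<open>Weak convergence of the penalised measures\<close>
  moreover define q where "q t \<Gamma> = QF P (\<lambda>t w. f (joint A t w)) x0 t \<Gamma>" for t \<Gamma>
  have q_lim: "((\<lambda>t. q t \<Gamma>) \<longlongrightarrow> (\<integral>w. indicator \<Gamma> w * M s w \<partial>?P)) at_top"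
    if s: "0 \<le> s" and \<Gamma>: "\<Gamma> \<in> sets (Filt s)" for s \<Gamma>
  proof -
    \<comment> \<open>\<open>QF\<close> is a quotient of real integrals with denominator E[f(Y_t)].
      As this equals \<open>D t\<close>, positive and finite, the quotient is the one treated in
      \<open>key\<close>.\<close>
    have eq: "ennreal (q t \<Gamma>) = (\<integral>\<^sup>+w. indicator \<Gamma> w * ennreal (f (Y t w)) \<partial>?P) / D t"
      if t: "0 \<le> t" for t
    proof -
      have fi: "integrable ?P (\<lambda>w. f (Y t w))"
        using measurable_compose[OF Y_P[OF t] f_borel] D_eq[OF t] D_pos[OF t] f0
        by (intro integrableI_nonneg) auto
      have "integrable ?P (\<lambda>w. indicator \<Gamma> w * f (Y t w))"
        using integrable_mult_indicator[OF \<Gamma>_P[OF \<Gamma>] fi] by simp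
      then have "(\<integral>\<^sup>+w. ennreal (indicator \<Gamma> w * f (Y t w)) \<partial>?P) = ennreal (\<integral>w. indicator \<Gamma> w * f (Y t w) \<partial>?P)"
        using f0 by (intro nn_integral_eq_integral) auto
      moreover have Dr: "D t = ennreal (\<integral>w. f (Y t w) \<partial>?P)"
        using nn_integral_eq_integral[OF fi] f0 D_eq[OF t] by simp
      moreover have "0 < (\<integral>w. f (Y t w) \<partial>?P)"
        using D_pos(1)[OF t] unfolding Dr by simp
      moreover have "0 \<le> (\<integral>w. indicator \<Gamma> w * f (Y t w) \<partial>?P)"
        using f0 by (intro Bochner_Integration.integral_nonneg) auto
      ultimately show ?thesis
        unfolding q_def QF_def Y_def[symmetric]
        using f0 by (simp add: divide_ennreal ennreal_mult' ennreal_indicator)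
    qed
    have "((\<lambda>t. ennreal (q t \<Gamma>)) \<longlongrightarrow> ennreal (\<integral>w. indicator \<Gamma> w * M s w \<partial>?P)) at_top"
      using key[OF s \<Gamma>] unfolding M_ind[OF s \<Gamma>_P[OF \<Gamma>]]
      by (rule Lim_transform_eventually)
         (rule eventually_mono[OF eventually_ge_at_top[of 0] eq[symmetric]])
    moreover have "0 \<le> q t \<Gamma>" for t
      unfolding q_def QF_def using f0 by (intro divide_nonneg_nonneg Bochner_Integration.integral_nonneg) auto
    moreover have "0 \<le> (\<integral>w. indicator \<Gamma> w * M s w \<partial>?P)"
      using M_nonneg by (intro Bochner_Integration.integral_nonneg) auto
    \<comment> \<open>Convergence in [0,\<infinity>] gives real convergence because both
      \<open>q\<close> and the limit are nonnegative.\<close>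
    ultimately show ?thesis
      by (simp add: tendsto_ennreal_iff)
  qed
  \<comment> \<open>\<open>QM\<close> must be one set function although \<open>\<Gamma>\<close> lies
    in many \<open>Filt s\<close>. Defining it as the limit of \<open>q t \<Gamma>\<close>, which
    does not mention \<open>s\<close>, makes the formulas for different \<open>s\<close> agree. Its
    value on sets in no \<open>Filt s\<close> is immaterial.\<close>
  have Q: "Lim at_top (\<lambda>t. q t \<Gamma>) = (\<integral>w. indicator \<Gamma> w * M s w \<partial>?P)"
    if "0 \<le> s" "\<Gamma> \<in> sets (Filt s)" for s \<Gamma>
    using q_lim[OF that] by (intro tendsto_Lim) auto
  have "((\<lambda>t. q t \<Gamma>) \<longlongrightarrow> Lim at_top (\<lambda>t. q t \<Gamma>)) at_top"
    if "0 < s" "\<Gamma> \<in> sets (Filt s)" for s \<Gamma>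
    using q_lim[of s \<Gamma>] Q[of s \<Gamma>] that by simp
  with Q have "\<exists>QM :: path set \<Rightarrow> real.
      (\<forall>s\<ge>0. \<forall>\<Gamma>\<in>sets (Filt s). QM \<Gamma> = (\<integral>w. indicator \<Gamma> w * M s w \<partial>?P)) \<and>
      (\<forall>s>0. \<forall>\<Gamma>\<in>sets (Filt s). ((\<lambda>t. q t \<Gamma>) \<longlongrightarrow> QM \<Gamma>) at_top)"
    by (intro exI[of _ "\<lambda>\<Gamma>. Lim at_top (\<lambda>t. q t \<Gamma>)"]) blast
  ultimately show ?thesis
    using M_nonneg unfolding q_def by blast
qed

end
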